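(* For any integer $n\geq 1$, $$\Phi(C_{2n})=\binom{n}{2} + \left\lfloor\frac{n}{2}\right\rfloor + 1.$$
   Context: $C_m$ denotes the cycle with vertices $0,1,\dots,m-1$ and edges $\{i,i+1 \bmod m\}$. For a connected graph $G$ with vertex set $V(G)$, a path system of $G$ is a set consisting of one chosen path in $G$ connecting $a$ and $b$ for each unordered pair $\{a,b\}$ of distinct vertices. A global packing of $(G,\mathcal{P})$ is a map $\omega:\mathcal{P}\to\{1,\dots,k\}$ such that $\omega(P)\neq\omega(P')$ whenever distinct paths $P,P'\in\mathcal{P}$ share at least one edge; $\Phi(G,\mathcal{P})$ is the minimum such $k$, and $\Phi(G)$ is the minimum of $\Phi(G,\mathcal{P})$ over all path systems $\mathcal{P}$ of $G$. *)

theory Defs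
  imports Complex_Main
begin

text \<open>Undirected graphs; an edge is the set of its end vertices.\<close>

record 'a ugraph =
  verts :: "'a set"
  edges :: "'a set set"

definition cycle_graph :: "nat \<Rightarrow> nat ugraph" where
  "cycle_graph m = \<lparr>verts = {..<m}, edges = {{i, (i + 1) mod m} | i. i < m}\<rparr>"

text \<open>
  A path is a subgraph rather than a vertex sequence, so a sequence and its reversal describe the
  same path, and \<open>connects G P a b\<close> is symmetric in \<open>a\<close> and \<open>b\<close>.
\<close>

definition path_graph :: "'a list \<Rightarrow> 'a ugraph" where
  "path_graph vs = \<lparr>verts = set vs, edges = {{vs ! i, vs ! (i + 1)} | i. i + 1 < length vs}\<rparr>"

definition connects :: "'a ugraph \<Rightarrow> 'a ugraph \<Rightarrow> 'a \<Rightarrow> 'a \<Rightarrow> bool" where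
  "connects G P a b \<longleftrightarrow>
     (\<exists>vs. vs \<noteq> [] \<and> distinct vs \<and> hd vs = a \<and> last vs = b \<and> P = path_graph vs) \<and>
     verts P \<subseteq> verts G \<and> edges P \<subseteq> edges G"

definition path_system :: "'a ugraph \<Rightarrow> 'a ugraph set \<Rightarrow> bool" where
  "path_system G \<P> \<longleftrightarrow>
     (\<forall>P\<in>\<P>. \<exists>a\<in>verts G. \<exists>b\<in>verts G. a \<noteq> b \<and> connects G P a b) \<and>
     (\<forall>a\<in>verts G. \<forall>b\<in>verts G. a \<noteq> b \<longrightarrow> (\<exists>!P. P \<in> \<P> \<and> connects G P a b))"

definition global_packing :: "'a ugraph set \<Rightarrow> nat \<Rightarrow> ('a ugraph \<Rightarrow> nat) \<Rightarrow> bool" where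
  "global_packing \<P> k \<omega> \<longleftrightarrow>
     (\<forall>P\<in>\<P>. \<omega> P \<in> {1..k}) \<and>
     (\<forall>P\<in>\<P>. \<forall>P'\<in>\<P>. P \<noteq> P' \<and> edges P \<inter> edges P' \<noteq> {} \<longrightarrow> \<omega> P \<noteq> \<omega> P')"

text \<open>
  Sharing an edge depends only on the paths, so the ambient graph is not an argument here.
  For a finite connected graph both minima below are attained.
\<close>

definition Phi_system :: "'a ugraph set \<Rightarrow> nat" where
  "Phi_system \<P> = (LEAST k. \<exists>\<omega>. global_packing \<P> k \<omega>)"

definition Phi :: "'a ugraph \<Rightarrow> nat" where
  "Phi G = (LEAST k. \<exists>\<P>. path_system G \<P> \<and> k = Phi_system \<P>)"

end

theory Submission
  imports Defs
begin

text \<open>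
  Lower bound: the antipodal edges \<open>i\<close> and \<open>i + n\<close> cut the cycle into two halves of \<open>n\<close>
  vertices, so at least \<open>n\<^sup>2\<close> paths use one of them, while a packing with \<open>k\<close> colours allows
  at most \<open>k\<close> paths on each edge; hence \<open>n\<^sup>2 \<le> 2 * k\<close>. For even \<open>n\<close>, equality would force all
  edges to carry the same number of paths. But the number of paths ending at a given vertex is
  odd, and these are the paths using exactly one of the two edges at it, so adjacent
  edges carry different numbers of paths.

  Upper bound: take shortest paths. For \<open>1 < c < n / 2\<close>, arcs of lengths \<open>c, n - c, c, n - c\<close>
  tile the cycle, and so do four arcs of length \<open>n / 2\<close>. Each of the \<open>n\<close> arcs of length \<open>n\<close> needs
  a colour of its own; its complement is tiled by an arc of length \<open>1\<close> and one of length \<open>n - 1\<close>.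
  The choice of one arc of length \<open>n\<close> for each antipodal pair is made in such a way that
  \<open>n div 2 + 1\<close> further colours suffice for the remaining arcs of lengths \<open>1\<close> and \<open>n - 1\<close>.
\<close>

section \<open>Paths as subgraphs: end vertices, reversal and cuts\<close>

definition cyc_edge :: "nat \<Rightarrow> nat \<Rightarrow> nat set" where
  "cyc_edge m i = {i, (i + 1) mod m}"

text \<open>A path is only a subgraph, so its end vertices have to be recovered from it: they are
  the vertices of odd degree.\<close>

definition path_ends :: "'a ugraph \<Rightarrow> 'a set" where
  "path_ends P = {v. odd (card {e \<in> edges P. v \<in> e})}"

lemma edges_path_graph_Cons:
  "edges (path_graph (x # y # zs)) = insert {x, y} (edges (path_graph (y # zs)))"
proof -
  have "{{(x # y # zs) ! i, (x # y # zs) ! (i + 1)} | i. i + 1 < length (x # y # zs)} =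
        insert {x, y} {{(y # zs) ! i, (y # zs) ! (i + 1)} | i. i + 1 < length (y # zs)}"
    (is "?L = insert _ ?R")
  proof (intro equalityI subsetI)
    fix e assume "e \<in> ?L"
    then obtain i where i: "e = {(x # y # zs) ! i, (x # y # zs) ! (i + 1)}"
      "i + 1 < length (x # y # zs)" by blast
    show "e \<in> insert {x, y} ?R"
      using i by (cases i) auto
  next
    fix e assume "e \<in> insert {x, y} ?R"
    then consider "e = {x, y}" | i where "e = {(y # zs) ! i, (y # zs) ! (i + 1)}"
      "i + 1 < length (y # zs)" by blast
    then show "e \<in> ?L"
    proof cases
      case 1
      then show ?thesis by (auto intro!: exI[of _ 0])
    next
      case (2 i)
      then show ?thesis by (auto intro!: exI[of _ "Suc i"])
    qed
  qed
  then show ?thesis by (simp add: path_graph_def)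
qed

lemma edges_path_graph_singleton: "edges (path_graph [x]) = {}"
  by (simp add: path_graph_def)

lemma finite_edges_path_graph: "finite (edges (path_graph vs))"
proof -
  have "{i. i + 1 < length vs} \<subseteq> {..<length vs}" by auto
  then show ?thesis by (simp add: path_graph_def finite_subset)
qed

lemma edges_path_graph_subset: "e \<in> edges (path_graph vs) \<Longrightarrow> e \<subseteq> set vs"
  by (auto simp: path_graph_def)

text \<open>Putting \<open>x\<close> in front adds one new edge, which flips the degree parity of
  \<open>x\<close> and \<open>y\<close> only. The exclusive or covers a single vertex, which has
  degree 0.\<close>

lemma odd_degree_path_graph:
  assumes "vs \<noteq> []" "distinct vs"
  shows "odd (card {e \<in> edges (path_graph vs). v \<in> e}) \<longleftrightarrow> (v = hd vs) \<noteq> (v = last vs)"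
  using assms
proof (induction vs rule: induct_list012)
  case 1
  then show ?case by simp
next
  case (2 x)
  then show ?case by (simp add: edges_path_graph_singleton)
next
  case (3 x y zs)
  let ?E = "edges (path_graph (y # zs))"
  have new: "{x, y} \<notin> ?E"
    using edges_path_graph_subset[of "{x, y}" "y # zs"] 3 by auto
  have IH: "odd (card {e \<in> ?E. v \<in> e}) \<longleftrightarrow> (v = y) \<noteq> (v = last (y # zs))"
    using 3 by simp
  have fin: "finite {e \<in> ?E. v \<in> e}" by (simp add: finite_edges_path_graph)
  show ?case
  proof (cases "v = x \<or> v = y")
    case True
    then have "{e \<in> edges (path_graph (x # y # zs)). v \<in> e} = insert {x, y} {e \<in> ?E. v \<in> e}"
      by (auto simp: edges_path_graph_Cons)
    then have "odd (card {e \<in> edges (path_graph (x # y # zs)). v \<in> e}) \<longleftrightarrow>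
        \<not> odd (card {e \<in> ?E. v \<in> e})"
      using new fin by simp
    then show ?thesis using IH True 3 by (auto split: if_splits)
  next
    case False
    then have "{e \<in> edges (path_graph (x # y # zs)). v \<in> e} = {e \<in> ?E. v \<in> e}"
      by (auto simp: edges_path_graph_Cons)
    then show ?thesis using IH False by simp
  qed
qed

lemma connects_path_ends:
  assumes "connects G P a b" "a \<noteq> b"
  shows "path_ends P = {a, b}"
proof -
  obtain vs where "vs \<noteq> []" "distinct vs" "hd vs = a" "last vs = b" "P = path_graph vs"
    using assms by (auto simp: connects_def)
  then show ?thesis
    using assms(2) by (auto simp: path_ends_def odd_degree_path_graph)
qed

lemma path_graph_rev: "path_graph (rev vs) = path_graph vs"
proof -
  have sub: "{{rev ws ! i, rev ws ! (i + 1)} | i. i + 1 < length (rev ws)} \<subseteq>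
      {{ws ! i, ws ! (i + 1)} | i. i + 1 < length ws}" for ws :: "'a list"
  proof
    fix e assume "e \<in> {{rev ws ! i, rev ws ! (i + 1)} | i. i + 1 < length (rev ws)}"
    then obtain i where i: "e = {rev ws ! i, rev ws ! (i + 1)}" "i + 1 < length ws" by auto
    \<comment> \<open>Reversal mirrors the edge positions
      \<open>0, ..., length ws - 2\<close>.\<close>
    define j where "j = length ws - 2 - i"
    have "rev ws ! i = ws ! (j + 1)" "rev ws ! (i + 1) = ws ! j" "j + 1 < length ws"
      using i by (auto simp: rev_nth j_def Suc_diff_Suc numeral_2_eq_2)
    then show "e \<in> {{ws ! i, ws ! (i + 1)} | i. i + 1 < length ws}"
      using i by (auto simp: insert_commute)
  qed
  show ?thesis using sub[of vs] sub[of "rev vs"] by (simp add: path_graph_def)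
qed

lemma connects_sym: "connects G P a b \<Longrightarrow> connects G P b a"
  unfolding connects_def
  by (metis distinct_rev hd_rev last_rev path_graph_rev rev_is_Nil_conv)

lemma path_graph_crosses_cut:
  assumes "vs \<noteq> []" "hd vs \<in> A" "last vs \<notin> A"
  shows "\<exists>x y. {x, y} \<in> edges (path_graph vs) \<and> x \<in> A \<and> y \<notin> A"
  using assms
proof (induction vs rule: induct_list012)
  case (3 x y zs)
  show ?case
  proof (cases "y \<in> A")
    case True
    then show ?thesis using 3 by (auto simp: edges_path_graph_Cons)
  next
    case False
    then show ?thesis using 3 by (auto simp: edges_path_graph_Cons)
  qed
qed auto

section \<open>Finite path systems and attained minima\<close>

lemma finite_path_system:
  assumes "path_system G \<P>" "finite (verts G)" "finite (edges G)"
  shows "finite \<P>"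
proof (rule finite_subset)
  show "\<P> \<subseteq> (\<lambda>(V, E). \<lparr>verts = V, edges = E\<rparr>) ` (Pow (verts G) \<times> Pow (edges G))"
  proof
    fix P assume "P \<in> \<P>"
    then have "verts P \<subseteq> verts G" "edges P \<subseteq> edges G"
      using assms(1) by (auto simp: path_system_def connects_def)
    then show "P \<in> (\<lambda>(V, E). \<lparr>verts = V, edges = E\<rparr>) ` (Pow (verts G) \<times> Pow (edges G))"
      by (intro image_eqI[of _ _ "(verts P, edges P)"]) auto
  qed
qed (use assms in auto)

lemma ex_global_packing:
  assumes "finite \<P>"
  shows "\<exists>k \<omega>. global_packing \<P> k \<omega>"
proof -
  obtain f :: "'a ugraph \<Rightarrow> nat" where "bij_betw f \<P> {1..card \<P>}"
    using assms by (metis card_atLeastAtMost diff_Suc_1 finite_atLeastAtMost finite_same_card_bij)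
  then have "global_packing \<P> (card \<P>) f"
    by (auto simp: global_packing_def bij_betw_def inj_on_def)
  then show ?thesis by blast
qed

text \<open>Finiteness gives every path system some packing, so the \<open>LEAST\<close> in
  \<open>Phi_system\<close> is attained and the bound \<open>lower\<close> on packings transfers to
  it.\<close>

lemma Phi_eqI:
  assumes fin: "finite (verts G)" "finite (edges G)"
    and system: "path_system G \<P>" and packing: "global_packing \<P> k \<omega>"
    and lower: "\<And>\<P> j \<omega>. path_system G \<P> \<Longrightarrow> global_packing \<P> j \<omega> \<Longrightarrow> k \<le> j"
  shows "Phi G = k"
proof -
  have ge: "k \<le> Phi_system \<Q>" if "path_system G \<Q>" for \<Q>
  proof -
    have "\<exists>j. \<exists>\<omega>. global_packing \<Q> j \<omega>"
      using ex_global_packing[OF finite_path_system[OF that fin]] by blast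
    then have "\<exists>\<omega>. global_packing \<Q> (Phi_system \<Q>) \<omega>"
      unfolding Phi_system_def by (rule LeastI_ex)
    then show ?thesis using lower that by blast
  qed
  have "Phi_system \<P> \<le> k"
    unfolding Phi_system_def using packing by (blast intro: Least_le)
  then have "Phi_system \<P> = k" using ge[OF system] by simp
  then show ?thesis
    unfolding Phi_def using system ge by (intro Least_equality) auto
qed

section \<open>Lower bound: loads of edges\<close>

text \<open>Any two paths through \<open>e\<close> share an edge, so \<omega> is injective on
  them.\<close>

lemma global_packing_load_le:
  assumes "global_packing \<P> k \<omega>"
  shows "finite {P \<in> \<P>. e \<in> edges P}" "card {P \<in> \<P>. e \<in> edges P} \<le> k"
proof -
  have "inj_on \<omega> {P \<in> \<P>. e \<in> edges P}" "\<omega> ` {P \<in> \<P>. e \<in> edges P} \<subseteq> {1..k}"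
    using assms by (auto simp: inj_on_def global_packing_def)
  then show "finite {P \<in> \<P>. e \<in> edges P}" "card {P \<in> \<P>. e \<in> edges P} \<le> k"
    using card_inj_on_le[of \<omega> _ "{1..k}"] inj_on_finite[of \<omega> _ "{1..k}"] by auto
qed

lemma edges_cycle_graph: "edges (cycle_graph m) = cyc_edge m ` {..<m}"
  by (auto simp: cycle_graph_def cyc_edge_def)

text \<open>An interval of vertices can be left only at its two ends; \<open>i < n\<close> keeps
  this one inside \<open>{..<2 * n}\<close>, so it does not wrap around.\<close>

lemma cycle_edge_crossing_half:
  assumes "i < n" "{x, y} \<in> edges (cycle_graph (2 * n))"
    "x \<in> {i<..i + n}" "y \<notin> {i<..i + n}"
  shows "{x, y} = cyc_edge (2 * n) i \<or> {x, y} = cyc_edge (2 * n) (i + n)"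
proof -
  obtain j where j: "j < 2 * n" "{x, y} = {j, (j + 1) mod (2 * n)}"
    using assms(2) by (auto simp: edges_cycle_graph cyc_edge_def)
  have "(j + 1) mod (2 * n) = (if j + 1 = 2 * n then 0 else j + 1)"
    using j(1) by auto
  then have "j = i \<or> j = i + n"
    using j assms(1,3,4) by (auto simp: doubleton_eq_iff split: if_splits)
  then show ?thesis using j by (auto simp: cyc_edge_def)
qed

lemma cycle_cut_load:
  assumes system: "path_system (cycle_graph (2 * n)) \<P>"
    and packing: "global_packing \<P> k \<omega>" and "i < n"
  shows "n * n \<le> card {P \<in> \<P>. cyc_edge (2 * n) i \<in> edges P} +
                 card {P \<in> \<P>. cyc_edge (2 * n) (i + n) \<in> edges P}"
    (is "_ \<le> card ?L + card ?L'")
proof -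
  let ?G = "cycle_graph (2 * n)"
  define A where "A = {i<..i + n}"
  define B where "B = {..<2 * n} - A"
  have V: "verts ?G = {..<2 * n}" by (simp add: cycle_graph_def)
  have "A \<subseteq> {..<2 * n}" using \<open>i < n\<close> by (auto simp: A_def)
  then have AB: "a \<in> verts ?G \<and> b \<in> verts ?G \<and> a \<noteq> b" if "a \<in> A" "b \<in> B" for a b
    using that V by (auto simp: B_def)
  have cards: "card A = n" "card B = n"
    using \<open>A \<subseteq> {..<2 * n}\<close> by (auto simp: A_def B_def card_Diff_subset)
  define p where "p = (\<lambda>(a, b). SOME P. P \<in> \<P> \<and> connects ?G P a b)"
  have p: "p (a, b) \<in> \<P> \<and> connects ?G (p (a, b)) a b" if "a \<in> A" "b \<in> B" for a b
  proof -
    have "\<exists>P. P \<in> \<P> \<and> connects ?G P a b"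
      using system AB[OF that] unfolding path_system_def by metis
    then show ?thesis unfolding p_def prod.case by (rule someI_ex)
  qed
  have ends: "path_ends (p (a, b)) = {a, b}" if "a \<in> A" "b \<in> B" for a b
    using connects_path_ends[of ?G "p (a, b)" a b] p[OF that] AB[OF that] by simp
  \<comment> \<open>A path determines the set of its ends, and disjointness of \<open>A\<close> and
    \<open>B\<close> tells which end is which.\<close>
  have "inj_on p (A \<times> B)"
  proof (rule inj_onI, clarify)
    fix a b a' b' assume *: "a \<in> A" "b \<in> B" "a' \<in> A" "b' \<in> B" "p (a, b) = p (a', b')"
    then have "{a, b} = {a', b'}" using ends by metis
    then show "a = a' \<and> b = b'" using * by (auto simp: B_def doubleton_eq_iff)
  qed
  moreover have "p ` (A \<times> B) \<subseteq> ?L \<union> ?L'"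
  proof (rule image_subsetI)
    fix z assume "z \<in> A \<times> B"
    then obtain a b where ab: "a \<in> A" "b \<in> B" and z: "z = (a, b)" by blast
    obtain vs where vs: "vs \<noteq> []" "hd vs = a" "last vs = b" "p (a, b) = path_graph vs"
      "edges (p (a, b)) \<subseteq> edges ?G"
      using p[OF ab] by (auto simp: connects_def)
    obtain x y where "{x, y} \<in> edges (p (a, b))" "x \<in> A" "y \<notin> A"
      using path_graph_crosses_cut[of vs A] vs ab by (auto simp: B_def)
    moreover from this have "{x, y} = cyc_edge (2 * n) i \<or> {x, y} = cyc_edge (2 * n) (i + n)"
      using cycle_edge_crossing_half[OF \<open>i < n\<close>, of x y] vs(5) unfolding A_def by blast
    ultimately show "p z \<in> ?L \<union> ?L'" using p[OF ab] by (auto simp: z)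
  qed
  moreover have "finite (?L \<union> ?L')" using global_packing_load_le[OF packing] by simp
  ultimately have "card (A \<times> B) \<le> card (?L \<union> ?L')"
    by (rule card_inj_on_le)
  also have "\<dots> \<le> card ?L + card ?L'" by (rule card_Un_le)
  finally show ?thesis using cards by (simp add: card_cartesian_product)
qed

text \<open>The symmetric difference has \<open>card A + card B - 2 * card (A \<inter> B)\<close>
  elements.\<close>

lemma odd_card_sym_diff:
  assumes "finite A" "finite B" "odd (card ((A - B) \<union> (B - A)))"
  shows "card A \<noteq> card B"
proof
  assume "card A = card B"
  moreover have "card A = card (A - B) + card (A \<inter> B)" "card B = card (B - A) + card (A \<inter> B)"
    using assms card_Diff_subset_Int[of A B] card_Diff_subset_Int[of B A]
      card_mono[of A "A \<inter> B"] card_mono[of B "A \<inter> B"] by (auto simp: Int_commute)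
  moreover have "card ((A - B) \<union> (B - A)) = card (A - B) + card (B - A)"
    using assms by (intro card_Un_disjoint) auto
  ultimately show False using assms(3) by simp
qed

text \<open>The two edges meet at vertex 1. The paths using exactly one of them are those ending at
  1, one for each of the \<open>2 * n - 1\<close> other vertices. \<open>n \<ge> 2\<close> makes the
  two edges distinct.\<close>

lemma cycle_adjacent_loads_differ:
  assumes system: "path_system (cycle_graph (2 * n)) \<P>"
    and packing: "global_packing \<P> k \<omega>" and "n \<ge> 2"
  shows "card {P \<in> \<P>. cyc_edge (2 * n) 0 \<in> edges P} \<noteq>
         card {P \<in> \<P>. cyc_edge (2 * n) 1 \<in> edges P}"
    (is "card ?L \<noteq> card ?L'")
proof (rule odd_card_sym_diff)
  let ?G = "cycle_graph (2 * n)"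
  let ?e = "cyc_edge (2 * n) 0" and ?e' = "cyc_edge (2 * n) 1"
  show "finite ?L" "finite ?L'" using global_packing_load_le[OF packing] by auto
  have V: "verts ?G = {..<2 * n}" by (simp add: cycle_graph_def)
  have e: "?e = {0, 1}" "?e' = {1, 2}" "?e \<noteq> ?e'"
    using \<open>n \<ge> 2\<close> by (auto simp: cyc_edge_def doubleton_eq_iff)
  have at1: "f = ?e \<or> f = ?e'" if f: "f \<in> edges ?G" "1 \<in> f" for f
  proof -
    obtain j where j: "j < 2 * n" "f = {j, (j + 1) mod (2 * n)}"
      using f(1) unfolding edges_cycle_graph cyc_edge_def by blast
    have "(j + 1) mod (2 * n) = (if j + 1 = 2 * n then 0 else j + 1)"
      using j(1) by auto
    then have "j = 0 \<or> j = 1" using f(2) j by (auto split: if_splits)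
    then show ?thesis using j by (auto simp: cyc_edge_def)
  qed
  have sub: "edges P \<subseteq> edges ?G" if "P \<in> \<P>" for P
    using that system by (auto simp: path_system_def connects_def)
  have deg: "1 \<in> path_ends P \<longleftrightarrow> (?e \<in> edges P) \<noteq> (?e' \<in> edges P)" if "P \<in> \<P>" for P
  proof -
    have "1 \<in> ?e" "1 \<in> ?e'" using e(1,2) by simp_all
    then have eq: "{f \<in> edges P. 1 \<in> f} = {?e, ?e'} \<inter> edges P"
      using at1 sub[OF that] by blast
    show ?thesis
      unfolding path_ends_def mem_Collect_eq eq using e(3)
      by (cases "?e \<in> edges P"; cases "?e' \<in> edges P") simp_all
  qed
  define q where "q b = (SOME P. P \<in> \<P> \<and> connects ?G P 1 b)" for b
  define W where "W = {..<2 * n} - {1}"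
  have W: "1 \<in> verts ?G" "\<And>b. b \<in> W \<Longrightarrow> b \<in> verts ?G \<and> 1 \<noteq> b"
    using \<open>n \<ge> 2\<close> by (auto simp: V W_def)
  have q: "q b \<in> \<P> \<and> connects ?G (q b) 1 b" if "b \<in> W" for b
  proof -
    have "\<exists>P. P \<in> \<P> \<and> connects ?G P 1 b"
      using system W that unfolding path_system_def by metis
    then show ?thesis unfolding q_def by (rule someI_ex)
  qed
  have ends: "path_ends (q b) = {1, b}" if "b \<in> W" for b
    using connects_path_ends[of ?G "q b" 1 b] q[OF that] W(2)[OF that] by simp
  have "inj_on q W"
  proof (rule inj_onI)
    fix b b' assume *: "b \<in> W" "b' \<in> W" "q b = q b'"
    then have "{1, b} = {1, b'}" using ends by metis
    then show "b = b'" using * W(2) by (auto simp: doubleton_eq_iff)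
  qed
  \<comment> \<open>Uniqueness in \<open>path_system\<close> enters here: a second path for the same
    pair would spoil the count.\<close>
  moreover have "q ` W = {P \<in> \<P>. 1 \<in> path_ends P}"
  proof (intro equalityI subsetI)
    fix P assume "P \<in> {P \<in> \<P>. 1 \<in> path_ends P}"
    then have P: "P \<in> \<P>" "1 \<in> path_ends P" by auto
    then obtain a b where ab: "a \<in> verts ?G" "b \<in> verts ?G" "a \<noteq> b" "connects ?G P a b"
      using system unfolding path_system_def by blast
    then have "1 = a \<or> 1 = b" using P connects_path_ends[of ?G P a b] by auto
    then obtain c where c: "c \<in> verts ?G" "1 \<noteq> c" "connects ?G P 1 c"
      using ab connects_sym by metis
    then have "c \<in> W" by (auto simp: W_def V)
    have "\<exists>!P. P \<in> \<P> \<and> connects ?G P 1 c"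
      using system c W(1) unfolding path_system_def by blast
    then have "P = q c" using q[OF \<open>c \<in> W\<close>] P c by blast
    then show "P \<in> q ` W" using \<open>c \<in> W\<close> by blast
  qed (use q ends in auto)
  ultimately have "card {P \<in> \<P>. 1 \<in> path_ends P} = card W"
    using card_image by metis
  moreover have "card W = 2 * n - 1"
    using \<open>n \<ge> 2\<close> by (simp add: W_def)
  moreover have "(?L - ?L') \<union> (?L' - ?L) = {P \<in> \<P>. 1 \<in> path_ends P}"
    using deg by auto
  ultimately show "odd (card ((?L - ?L') \<union> (?L' - ?L)))"
    using \<open>n \<ge> 2\<close> by simp
qed

lemma double_choose_two: "2 * (n choose 2) + n = n * n"
  by (cases n) (simp_all add: choose_two)

lemma cycle_packing_lower_bound:
  assumes "n \<ge> 1" and system: "path_system (cycle_graph (2 * n)) \<P>"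
    and packing: "global_packing \<P> k \<omega>"
  shows "(n choose 2) + n div 2 + 1 \<le> k"
proof (rule ccontr)
  assume "\<not> ?thesis"
  then have k: "2 * k \<le> 2 * (n choose 2) + 2 * (n div 2)" by simp
  define L where "L i = card {P \<in> \<P>. cyc_edge (2 * n) i \<in> edges P}" for i
  have le: "L i \<le> k" for i
    using global_packing_load_le(2)[OF packing] by (simp add: L_def)
  have cut: "2 * (n choose 2) + n \<le> L i + L (i + n)" if "i < n" for i
    using cycle_cut_load[OF system packing that] double_choose_two[of n] by (simp add: L_def)
  \<comment> \<open>For odd \<open>n\<close> the cut bound alone contradicts \<open>k\<close>, since
    \<open>2 * (n div 2) < n\<close>.\<close>
  have "even n"
  proof (rule ccontr)
    assume "odd n"
    then have "2 * (n div 2) < n" by presburger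
    then show False using cut[of 0] le[of 0] le[of n] k \<open>n \<ge> 1\<close> by simp
  qed
  then have "n \<ge> 2" using \<open>n \<ge> 1\<close> by (auto elim!: evenE)
  \<comment> \<open>Now \<open>2 * k\<close> is at most the cut bound, so both edges of every
    antipodal pair are loaded to capacity.\<close>
  have "L 0 = k" "L 1 = k"
    using cut[of 0] le[of 0] le[of n] cut[of 1] le[of 1] le[of "1 + n"] k \<open>n \<ge> 2\<close> \<open>even n\<close> by auto
  then show False
    using cycle_adjacent_loads_differ[OF system packing \<open>n \<ge> 2\<close>] by (simp add: L_def)
qed

section \<open>Arcs of the cycle\<close>

definition arc :: "nat \<Rightarrow> nat \<Rightarrow> nat \<Rightarrow> nat ugraph" where
  "arc m s l = path_graph (map (\<lambda>i. (s + i) mod m) [0..<Suc l])"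

lemma inj_on_add_mod:
  fixes m s l :: nat
  assumes "l < m"
  shows "inj_on (\<lambda>i. (s + i) mod m) {..l}"
proof (rule linorder_inj_onI')
  fix i j assume ij: "i \<in> {..l}" "j \<in> {..l}" "i < j"
  have "\<not> m dvd j - i" using ij assms by (intro nat_dvd_not_less) auto
  then show "(s + i) mod m \<noteq> (s + j) mod m"
    using mod_eq_dvd_iff_nat[of "s + i" "s + j" m] ij by auto
qed

lemma edges_arc: "edges (arc m s l) = (\<lambda>i. cyc_edge m ((s + i) mod m)) ` {..<l}"
proof -
  have "{map (\<lambda>i. (s + i) mod m) [0..<Suc l] ! i, map (\<lambda>i. (s + i) mod m) [0..<Suc l] ! (i + 1)} =
      cyc_edge m ((s + i) mod m)" if "i < l" for i
  proof -
    have "map (\<lambda>i. (s + i) mod m) [0..<Suc l] ! i = (s + i) mod m"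
      using that by (subst nth_map) (auto simp del: upt_Suc)
    moreover have "map (\<lambda>i. (s + i) mod m) [0..<Suc l] ! (i + 1) = ((s + i) mod m + 1) mod m"
      using that by (subst nth_map) (auto simp del: upt_Suc simp: mod_Suc_eq)
    ultimately show ?thesis by (simp add: cyc_edge_def del: upt_Suc)
  qed
  then have "{{map (\<lambda>i. (s + i) mod m) [0..<Suc l] ! i, map (\<lambda>i. (s + i) mod m) [0..<Suc l] ! (i + 1)} | i.
      i < l} = (\<lambda>i. cyc_edge m ((s + i) mod m)) ` {..<l}" by blast
  then show ?thesis
    unfolding arc_def path_graph_def by (simp del: upt_Suc)
qed

lemma connects_arc:
  assumes "s < m" "l < m"
  shows "connects (cycle_graph m) (arc m s l) s ((s + l) mod m)"
  unfolding connects_def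
proof (intro conjI)
  let ?vs = "map (\<lambda>i. (s + i) mod m) [0..<Suc l]"
  have "distinct ?vs"
    using inj_on_add_mod[OF assms(2), of s]
    by (simp add: distinct_map atLeast0LessThan lessThan_Suc_atMost del: upt_Suc)
  moreover have "hd ?vs = s" using assms by (simp add: hd_map del: upt_Suc)
  moreover have "last ?vs = (s + l) mod m" by simp
  ultimately show "\<exists>vs. vs \<noteq> [] \<and> distinct vs \<and> hd vs = s \<and> last vs = (s + l) mod m \<and>
      arc m s l = path_graph vs"
    unfolding arc_def by (intro exI[of _ ?vs]) simp
  show "verts (arc m s l) \<subseteq> verts (cycle_graph m)"
    using assms by (auto simp: arc_def path_graph_def cycle_graph_def)
  show "edges (arc m s l) \<subseteq> edges (cycle_graph m)"
    using assms by (auto simp: edges_arc edges_cycle_graph)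
qed

text \<open>For \<open>m = 2\<close> the edges 0 and 1 coincide; from \<open>m = 3\<close> on, no
  two vertices are successors of each other.\<close>

lemma cyc_edge_inject:
  assumes "m \<ge> 3" "i < m" "j < m" "cyc_edge m i = cyc_edge m j"
  shows "i = j"
proof -
  have "(k + 1) mod m = (if k + 1 = m then 0 else k + 1)" if "k < m" for k
    using that by auto
  then show ?thesis
    using assms by (auto simp: cyc_edge_def doubleton_eq_iff split: if_splits)
qed

section \<open>Shortest arcs as a path system\<close>

text \<open>A set of representatives of the residues modulo \<open>n\<close> in \<open>{..<2 * n}\<close>. It selects the
  starting points of the paths of length \<open>n\<close>, one for each antipodal pair.\<close>

definition diam_starts :: "nat \<Rightarrow> nat set" where
  "diam_starts n = {t. t < n \<and> even t \<or> n < t \<and> t < 2 * n \<and> even (t - n - 1)}"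

text \<open>Arcs always run upwards from their start, so a pair at distance below \<open>n\<close>
  corresponds to one start and one length. Only at distance \<open>n\<close> do two arcs compete,
  and \<open>diam_starts\<close> decides.\<close>

definition short_arcs :: "nat \<Rightarrow> (nat \<times> nat) set" where
  "short_arcs n = {(s, l). s < 2 * n \<and> 0 < l \<and> (l < n \<or> l = n \<and> s \<in> diam_starts n)}"

lemma add_mod_double:
  fixes n s l :: nat
  assumes "s < 2 * n" "l \<le> n"
  shows "(s + l) mod (2 * n) = (if s + l < 2 * n then s + l else s + l - 2 * n)"
  using assms by (auto simp: mod_if)

text \<open>An even \<open>t\<close> is selected itself, an odd \<open>t\<close> through
  \<open>t + n\<close>. The strict \<open>n < t\<close> in the definition matters for 0: truncated
  subtraction would otherwise select \<open>n\<close> as well.\<close>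

lemma diam_starts_opposite:
  assumes "t < n"
  shows "t + n \<in> diam_starts n \<longleftrightarrow> t \<notin> diam_starts n"
  using assms by (cases t) (auto simp: diam_starts_def)

lemma ex_short_arc:
  assumes "a < b" "b < 2 * n"
  shows "\<exists>(s, l) \<in> short_arcs n. {s, (s + l) mod (2 * n)} = {a, b}"
proof -
  consider "b - a < n" | "b = a + n" | "b - a > n" using assms by linarith
  then show ?thesis
  proof cases
    case 1
    then show ?thesis
      using assms by (intro bexI[of _ "(a, b - a)"]) (auto simp: short_arcs_def)
  next
    case 2
    show ?thesis
    proof (cases "a \<in> diam_starts n")
      case True
      then show ?thesis
        using assms 2 by (intro bexI[of _ "(a, n)"]) (auto simp: short_arcs_def)
    next
      case False
      then have "b \<in> diam_starts n" using 2 assms diam_starts_opposite by simp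
      then show ?thesis
        using assms 2 by (intro bexI[of _ "(b, n)"]) (auto simp: short_arcs_def add_mod_double)
    qed
  next
    case 3
    \<comment> \<open>The shorter arc starts at \<open>b\<close> and passes through 0 to reach
      \<open>a\<close>.\<close>
    then show ?thesis
      using assms
      by (intro bexI[of _ "(b, 2 * n - (b - a))"]) (auto simp: short_arcs_def add_mod_double)
  qed
qed

lemma short_arc_unique:
  assumes "(s, l) \<in> short_arcs n" "(s', l') \<in> short_arcs n"
    "{s, (s + l) mod (2 * n)} = {s', (s' + l') mod (2 * n)}"
  shows "s = s' \<and> l = l'"
proof -
  have b: "s < 2 * n" "l \<le> n" "s' < 2 * n" "l' \<le> n" "0 < l" "0 < l'"
    using assms by (auto simp: short_arcs_def)
  \<comment> \<open>If the two arcs run between the same ends in opposite senses, their lengths add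
    up to \<open>2 * n\<close>, so both are \<open>n\<close>.\<close>
  consider "s = s'" "l = l'" | "l = n" "l' = n" "s' = s + n" | "l = n" "l' = n" "s = s' + n"
    using assms(3) b
    by (auto simp: add_mod_double doubleton_eq_iff split: if_splits)
  then show ?thesis
    using assms(1,2) diam_starts_opposite[of s n] diam_starts_opposite[of s' n]
    by cases (auto simp: short_arcs_def)
qed

lemma path_system_short_arcs:
  "path_system (cycle_graph (2 * n)) ((\<lambda>(s, l). arc (2 * n) s l) ` short_arcs n)"
proof -
  let ?G = "cycle_graph (2 * n)"
  have V: "verts ?G = {..<2 * n}" by (simp add: cycle_graph_def)
  have con: "connects ?G (arc (2 * n) s l) s ((s + l) mod (2 * n))"
    and ne: "s \<noteq> (s + l) mod (2 * n)" and vert: "s < 2 * n" "(s + l) mod (2 * n) < 2 * n"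
    if "(s, l) \<in> short_arcs n" for s l
  proof -
    have b: "s < 2 * n" "l \<le> n" "0 < l" using that by (auto simp: short_arcs_def)
    then show "s < 2 * n" "(s + l) mod (2 * n) < 2 * n" by auto
    show "connects ?G (arc (2 * n) s l) s ((s + l) mod (2 * n))"
      using b by (intro connects_arc) auto
    show "s \<noteq> (s + l) mod (2 * n)" using b by (auto simp: add_mod_double)
  qed
  have ends: "{s, (s + l) mod (2 * n)} = {a, b}"
    if "(s, l) \<in> short_arcs n" "connects ?G (arc (2 * n) s l) a b" "a \<noteq> b" for s l a b
    using connects_path_ends[OF con ne] connects_path_ends[of ?G "arc (2 * n) s l" a b] that by simp
  have ex1: "\<exists>!P. P \<in> (\<lambda>(s, l). arc (2 * n) s l) ` short_arcs n \<and> connects ?G P a b"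
    if ab: "a < 2 * n" "b < 2 * n" "a \<noteq> b" for a b
  proof -
    obtain s l where sl: "(s, l) \<in> short_arcs n" "{s, (s + l) mod (2 * n)} = {a, b}"
      using ex_short_arc[of a b n] ex_short_arc[of b a n] ab
      by (cases "a < b") (auto simp: insert_commute)
    have "connects ?G (arc (2 * n) s l) a b"
      using con[OF sl(1)] sl(2) connects_sym[OF con[OF sl(1)]] by (auto simp: doubleton_eq_iff)
    moreover have "P = arc (2 * n) s l"
      if P: "P \<in> (\<lambda>(s, l). arc (2 * n) s l) ` short_arcs n" "connects ?G P a b" for P
    proof -
      obtain s' l' where s'l': "(s', l') \<in> short_arcs n" "P = arc (2 * n) s' l'"
        using P(1) by auto
      then have "{s', (s' + l') mod (2 * n)} = {a, b}"
        using ends P(2) ab(3) by blast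
      then show ?thesis
        using short_arc_unique[OF s'l'(1) sl(1)] sl(2) s'l'(2) by simp
    qed
    ultimately show ?thesis using sl(1) by (intro ex1I[of _ "arc (2 * n) s l"]) auto
  qed
  show ?thesis
    unfolding path_system_def
  proof (intro conjI ballI impI)
    fix P assume "P \<in> (\<lambda>(s, l). arc (2 * n) s l) ` short_arcs n"
    then obtain s l where "(s, l) \<in> short_arcs n" "P = arc (2 * n) s l" by auto
    then show "\<exists>a\<in>verts ?G. \<exists>b\<in>verts ?G. a \<noteq> b \<and> connects ?G P a b"
      using con ne vert V by (metis lessThan_iff)
  next
    fix a b assume "a \<in> verts ?G" "b \<in> verts ?G" "a \<noteq> b"
    then show "\<exists>!P. P \<in> (\<lambda>(s, l). arc (2 * n) s l) ` short_arcs n \<and> connects ?G P a b"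
      using ex1 V by simp
  qed
qed

section \<open>From colourings of arcs to packings\<close>

text \<open>Lets indices of paths be coloured by an arbitrary finite set: \<open>inv_into\<close>
  fixes one index for each path, and \<open>g\<close> numbers the colours.\<close>

lemma global_packing_of_colouring:
  assumes "finite C" "card C \<le> k" "c ` I \<subseteq> C"
    and disj: "\<And>i j. i \<in> I \<Longrightarrow> j \<in> I \<Longrightarrow> c i = c j \<Longrightarrow> edges (f i) \<inter> edges (f j) \<noteq> {} \<Longrightarrow> i = j"
  shows "\<exists>\<omega>. global_packing (f ` I) k \<omega>"
proof -
  obtain g where g: "bij_betw g C {1..card C}"
    using assms(1) by (metis card_atLeastAtMost diff_Suc_1 finite_atLeastAtMost finite_same_card_bij)
  define \<omega> where "\<omega> P = g (c (inv_into I f P))" for P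
  have inv: "inv_into I f P \<in> I" "f (inv_into I f P) = P" if "P \<in> f ` I" for P
    using that by (auto simp: inv_into_into f_inv_into_f)
  have "\<omega> P \<in> {1..k}" if "P \<in> f ` I" for P
  proof -
    have "c (inv_into I f P) \<in> C" using assms(3) inv[OF that] by blast
    then have "\<omega> P \<in> {1..card C}" using g by (auto simp: \<omega>_def bij_betw_def)
    then show ?thesis using assms(2) by auto
  qed
  moreover have "P = P'" if P: "P \<in> f ` I" "P' \<in> f ` I" "edges P \<inter> edges P' \<noteq> {}" "\<omega> P = \<omega> P'"
    for P P'
  proof -
    have "c (inv_into I f P) \<in> C" "c (inv_into I f P') \<in> C"
      using assms(3) inv P by blast+
    then have "c (inv_into I f P) = c (inv_into I f P')"
      using P(4) g by (auto simp: \<omega>_def bij_betw_def inj_on_def)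
    then have "inv_into I f P = inv_into I f P'"
      using disj inv P by metis
    then show ?thesis using inv P by metis
  qed
  ultimately show ?thesis unfolding global_packing_def by blast
qed

text \<open>As \<open>2 * n \<ge> 4\<close>, edges correspond to positions modulo
  \<open>2 * n\<close>, so sharing an edge becomes a congruence.\<close>

lemma short_arcs_packing:
  assumes "n \<ge> 2" "finite C" "card C \<le> k"
    and range: "\<And>s l. (s, l) \<in> short_arcs n \<Longrightarrow> c s l \<in> C"
    and disj: "\<And>s l s' l' i i'. (s, l) \<in> short_arcs n \<Longrightarrow> (s', l') \<in> short_arcs n \<Longrightarrow>
      c s l = c s' l' \<Longrightarrow> i < l \<Longrightarrow> i' < l' \<Longrightarrow>
      (s + i) mod (2 * n) = (s' + i') mod (2 * n) \<Longrightarrow> s = s' \<and> l = l'"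
  shows "\<exists>\<omega>. global_packing ((\<lambda>(s, l). arc (2 * n) s l) ` short_arcs n) k \<omega>"
proof (rule global_packing_of_colouring[where c = "\<lambda>(s, l). c s l", OF assms(2,3)])
  show "(\<lambda>(s, l). c s l) ` short_arcs n \<subseteq> C" using range by auto
next
  fix x y :: "nat \<times> nat"
  assume xy: "x \<in> short_arcs n" "y \<in> short_arcs n"
      "(case x of (s, l) \<Rightarrow> c s l) = (case y of (s, l) \<Rightarrow> c s l)"
    and meet: "edges (case x of (s, l) \<Rightarrow> arc (2 * n) s l) \<inter>
      edges (case y of (s, l) \<Rightarrow> arc (2 * n) s l) \<noteq> {}"
  obtain s l s' l' where eq: "x = (s, l)" "y = (s', l')" by fastforce
  obtain i i' where i: "i < l" "i' < l'"
      "cyc_edge (2 * n) ((s + i) mod (2 * n)) = cyc_edge (2 * n) ((s' + i') mod (2 * n))"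
    using meet unfolding eq by (auto simp: edges_arc)
  have "(s + i) mod (2 * n) = (s' + i') mod (2 * n)"
    using \<open>n \<ge> 2\<close> by (intro cyc_edge_inject[OF _ _ _ i(3)]) auto
  then show "x = y" using disj[of s l s' l' i i'] xy i unfolding eq by simp
qed

section \<open>The colouring for n >= 3\<close>

text \<open>
  The arc of length \<open>l\<close> starting at \<open>s\<close> gets a pair as colour. First component 0: the arcs of
  lengths \<open>1\<close> and \<open>n - 1\<close> with start \<open>t\<close> and \<open>t + 1\<close> for \<open>t\<close> in \<open>diam_starts n\<close>; those of length
  \<open>n - 1\<close> are paired as \<open>t, t + n + 1\<close>. First component 1: an arc of length \<open>n\<close> and the tiling of
  its complement. First component \<open>c \<ge> 2\<close>: the tilings by arcs of lengths \<open>c\<close> and \<open>n - c\<close>.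
\<close>

definition colour :: "nat \<Rightarrow> nat \<Rightarrow> nat \<Rightarrow> nat \<times> nat" where
  "colour n s l =
    (if l = n then (1, s mod n)
     else if l = 1 then
       if s \<in> diam_starts n then (0, if s < n then n div 2 else (s - n - 1) div 2)
       else (1, s mod n)
     else if l = n - 1 then
       let t = (if s = 0 then 2 * n - 1 else s - 1) in
       if t \<in> diam_starts n then (0, if t < n then t div 2 else (t - n - 1) div 2)
       else (1, t mod n)
     else if 2 * l < n then (l, s mod n)
     else if 2 * l = n then (l, s mod l)
     else (n - l, (s + l) mod n))"

definition colours :: "nat \<Rightarrow> (nat \<times> nat) set" where
  "colours n = {0} \<times> {..n div 2} \<union> {1..(n - 1) div 2} \<times> {..<n} \<union>
     (if even n then {n div 2} \<times> {..<n div 2} else {})"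

lemma card_colours:
  assumes "n \<ge> 3"
  shows "finite (colours n)" "card (colours n) \<le> (n choose 2) + n div 2 + 1"
proof -
  show "finite (colours n)" by (simp add: colours_def)
  have "card (colours n) \<le> card ({0::nat} \<times> {..n div 2}) + card ({1..(n - 1) div 2} \<times> {..<n}) +
     card (if even n then {n div 2} \<times> {..<n div 2} else {})"
    unfolding colours_def by (intro order.trans[OF card_Un_le] add_right_mono card_Un_le)
  also have "\<dots> = n div 2 + 1 + ((n - 1) div 2 * n + (if even n then n div 2 else 0))"
    by (simp add: card_cartesian_product)
  \<comment> \<open>Odd \<open>n\<close>: (n - 1) / 2 classes of \<open>n\<close> colours. Even
    \<open>n\<close>: n / 2 - 1 such classes, and n / 2 colours for the arcs of length n /
    2.\<close>
  also have "(n - 1) div 2 * n + (if even n then n div 2 else 0) = n choose 2"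
  proof (cases "even n")
    case True
    then obtain j where "n = 2 * j" by (auto elim: evenE)
    then have "j \<ge> 1" "n = 2 * j" using assms by auto
    then show ?thesis using double_choose_two[of n] by (cases j) (auto simp: algebra_simps)
  next
    case False
    then obtain j where "n = 2 * j + 1" by (auto elim: oddE)
    then show ?thesis using double_choose_two[of n] by (auto simp: algebra_simps)
  qed
  finally show "card (colours n) \<le> (n choose 2) + n div 2 + 1" by simp
qed

lemma mod_double_cases:
  fixes s n :: nat
  assumes "s < 2 * n"
  shows "s mod n < n \<and> (s = s mod n \<or> s = s mod n + n)"
  using assms by (auto simp: mod_if)

lemma diam_starts_iff:
  assumes "x < n"
  shows "x \<in> diam_starts n \<longleftrightarrow> even x" "x + n \<in> diam_starts n \<longleftrightarrow> odd x"
  using diam_starts_opposite[OF assms] assms by (auto simp: diam_starts_def)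

text \<open>Inverts \<open>colour\<close>: each arc of a given colour is described by linear
  equations and parities, free of \<open>div\<close> and \<open>mod\<close> except in
  \<open>unit_low\<close>, so that disjointness becomes arithmetic.\<close>

lemma colour_cases:
  assumes "n \<ge> 3" "(s, l) \<in> short_arcs n" "colour n s l = (c, x)"
  obtains
    (unit_low) "c = 0" "l = 1" "x = n div 2" "even s" "s < n"
  | (unit_high) "c = 0" "l = 1" "s = n + 1 + 2 * x" "s < 2 * n"
  | (long_low) "c = 0" "l = n - 1" "s = 2 * x + 1" "s \<le> n"
  | (long_high) "c = 0" "l = n - 1" "s = n + 2 + 2 * x" "s < 2 * n"
  | (long_zero) "c = 0" "l = n - 1" "s = 0" "n = 2 * x + 2"
  | (diam) "c = 1" "l = n" "x < n" "even x \<and> s = x \<or> odd x \<and> s = x + n"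
  | (unit_diam) "c = 1" "l = 1" "x < n" "even x \<and> s = x + n \<or> odd x \<and> s = x"
  | (long_diam) "c = 1" "l = n - 1" "x < n"
      "even x \<and> (s = x + n + 1 \<or> s = 0 \<and> x = n - 1) \<or> odd x \<and> s = x + 1"
  | (lower) "2 \<le> c" "2 * c < n" "l = c" "x < n" "s = x \<or> s = x + n"
  | (upper) "2 \<le> c" "2 * c < n" "l = n - c" "x < n" "s + n = x + c \<or> s = x + c \<or> s = x + c + n"
  | (middle) "2 \<le> c" "2 * c = n" "l = c" "x < c"
      "s = x \<or> s = x + c \<or> s = x + 2 * c \<or> s = x + 3 * c"
proof -
  note col = assms(3)[unfolded colour_def]
  have s: "s < 2 * n" "0 < l" "l \<le> n" "l = n \<Longrightarrow> s \<in> diam_starts n"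
    using assms(2) by (auto simp: short_arcs_def)
  consider "l = n" | "l = 1" | "l = n - 1" "l \<noteq> 1" | "1 < l" "2 * l < n" | "1 < l" "2 * l = n"
    | "n < 2 * l" "l < n - 1"
    using s(2,3) assms(1) by atomize_elim presburger
  then show ?thesis
  proof cases
    case 1
    then have x: "c = 1" "x = s mod n" using col by auto
    then have "x < n" "s = x \<or> s = x + n" using mod_double_cases[OF s(1)] by auto
    then show ?thesis using diam x 1 s(4) diam_starts_iff[of x n] by auto
  next
    case 2
    show ?thesis
    proof (cases "s \<in> diam_starts n")
      case True
      then show ?thesis
        using col 2 assms(1) unit_low unit_high by (cases "s < n") (auto simp: diam_starts_def)
    next
      case False
      then have x: "c = 1" "x = s mod n" using col 2 assms(1) by auto
      then have "x < n" "s = x \<or> s = x + n" using mod_double_cases[OF s(1)] by auto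
      then show ?thesis using unit_diam x 2 False diam_starts_iff[of x n] by auto
    qed
  next
    case 3
    \<comment> \<open>The edge just before the arc, that is \<open>s - 1\<close> modulo
      \<open>2 * n\<close>; the wrap at \<open>s = 0\<close> is the source of
      \<open>long_zero\<close> and of the extra alternative in \<open>long_diam\<close>.\<close>
    define t where "t = (if s = 0 then 2 * n - 1 else s - 1)"
    have t: "t < 2 * n" "s = t + 1 \<or> s = 0 \<and> t = 2 * n - 1"
      using s assms(1) by (auto simp: t_def)
    have "l \<noteq> n" using 3 assms(1) by simp
    have col': "(if t \<in> diam_starts n then (0, if t < n then t div 2 else (t - n - 1) div 2)
       else (1, t mod n)) = (c, x)"
      using col
      unfolding Let_def t_def[symmetric] if_not_P[OF \<open>l \<noteq> n\<close>] if_not_P[OF 3(2)] if_P[OF 3(1)] .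
    show ?thesis
    proof (cases "t \<in> diam_starts n")
      case True
      show ?thesis
      proof (cases "t < n")
        case True
        with \<open>t \<in> diam_starts n\<close> have "c = 0" "t = 2 * x" using col' by (auto simp: diam_starts_def)
        then show ?thesis using t True 3 long_low assms(1) by auto
      next
        case False
        with \<open>t \<in> diam_starts n\<close> have "c = 0" "t = n + 1 + 2 * x"
          using col' by (auto simp: diam_starts_def)
        then show ?thesis using t s(1) False 3 long_high long_zero by auto
      qed
    next
      case False
      then have x: "c = 1" "x = t mod n" using col' by auto
      then have xt: "x < n" "t = x \<or> t = x + n" using mod_double_cases[OF t(1)] by auto
      have "even x \<and> t = x + n \<or> odd x \<and> t = x"
        using xt False diam_starts_iff[of x n] by auto
      then have "even x \<and> (s = x + n + 1 \<or> s = 0 \<and> x = n - 1) \<or> odd x \<and> s = x + 1"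
        using t(2) xt(1) by auto
      then show ?thesis using long_diam x xt 3 by blast
    qed
  next
    case 4
    then have "l \<noteq> n" "l \<noteq> 1" "l \<noteq> n - 1" by linarith+
    then have x: "c = l" "x = s mod n" using col 4 by simp_all
    then have "x < n" "s = x \<or> s = x + n" using mod_double_cases[OF s(1)] by auto
    moreover have "2 \<le> c" "2 * c < n" using x(1) 4 by simp_all
    ultimately show ?thesis using lower x(1) by blast
  next
    case 5
    then have "l \<noteq> n" "l \<noteq> 1" "l \<noteq> n - 1" using assms(1) by linarith+
    then have x: "c = l" "x = s mod l" using col 5 by auto
    have "x < l" using x 5 by simp
    moreover have "s = x \<or> s = x + l \<or> s = x + 2 * l \<or> s = x + 3 * l"
    proof -
      have "s mod n < n" "s = s mod n \<or> s = s mod n + n" using mod_double_cases[OF s(1)] by auto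
      moreover have "s mod n mod l = x"
        using x 5 by (metis dvd_triv_right mod_mod_cancel)
      moreover have "s mod n = s mod n mod l \<or> s mod n = s mod n mod l + l"
        using mod_double_cases[of "s mod n" l] \<open>s mod n < n\<close> 5 by simp
      ultimately show ?thesis using 5 by auto
    qed
    moreover have "2 \<le> c" "2 * c = n" using x(1) 5 by simp_all
    ultimately show ?thesis using middle x(1) by blast
  next
    case 6
    then have "l \<noteq> n" "l \<noteq> 1" "l \<noteq> n - 1" "\<not> 2 * l < n" "2 * l \<noteq> n"
      using assms(1) by linarith+
    then have x: "c = n - l" "x = (s + l) mod n" using col by auto
    have "x < n" using x assms(1) by simp
    moreover have "s + n = x + c \<or> s = x + c \<or> s = x + c + n"
    proof -
      \<comment> \<open>Here \<open>s + l < 3 * n\<close>, so at most two multiples of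
        \<open>n\<close> are removed.\<close>
      have "s + l = x \<or> s + l = x + n \<or> s + l = x + 2 * n"
      proof (cases "s + l < n")
        case True
        then show ?thesis using x(2) by simp
      next
        case False
        then have "x = (s + l - n) mod n" "s + l - n < 2 * n"
          using x(2) le_mod_geq[of n "s + l"] s 6 by auto
        then have "s + l - n = x \<or> s + l - n = x + n"
          using mod_double_cases[of "s + l - n" n] by simp
        then show ?thesis using False by linarith
      qed
      then show ?thesis using x(1) s 6 by auto
    qed
    moreover have "2 \<le> c" "2 * c < n" "l = n - c" using x(1) 6 s by auto
    ultimately show ?thesis using upper by blast
  qed
qed

lemma colour_in_colours:
  assumes "n \<ge> 3" "(s, l) \<in> short_arcs n"
  shows "colour n s l \<in> colours n"
proof -
  obtain c x where cx: "colour n s l = (c, x)" by fastforce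
  have "1 \<le> (n - 1) div 2" "2 * c < n \<longrightarrow> c \<le> (n - 1) div 2"
    "2 * x \<le> n \<longrightarrow> x \<le> n div 2" "2 * c = n \<longrightarrow> even n \<and> n div 2 = c"
    using assms(1) by auto
  with assms cx have "(c, x) \<in> colours n"
    by (cases rule: colour_cases) (simp_all add: colours_def split del: if_split)
  then show ?thesis by (simp add: cx)
qed

text \<open>Each colour belongs to disjoint arcs, with positions modulo \<open>2 * n\<close>. Colour
  \<open>(0, x)\<close> with \<open>2 * x + 1 < n\<close>: length \<open>n - 1\<close> from
  \<open>2 * x + 1\<close>, length 1 from \<open>2 * x + n + 1\<close>, length \<open>n - 1\<close>
  from \<open>2 * x + n + 2\<close>; only the edge \<open>2 * x + n\<close> stays free. Colour
  \<open>(0, n div 2)\<close>: the edges at even positions below \<open>n\<close> and, for odd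
  \<open>n\<close>, length \<open>n - 1\<close> from \<open>n\<close>. Colour \<open>(1, x)\<close>:
  length \<open>n\<close> from some \<open>t\<close>, length 1 from \<open>t + n\<close>, length
  \<open>n - 1\<close> from \<open>t + n + 1\<close>. Colour \<open>(c, x)\<close> with
  \<open>2 \<le> c\<close> and \<open>2 * c < n\<close>: lengths \<open>c, n - c, c, n - c\<close>
  in succession from \<open>x\<close>; with \<open>2 * c = n\<close>, four arcs of length
  \<open>c\<close> from \<open>x\<close>.\<close>

lemma colour_disjoint:
  assumes "n \<ge> 3" "(s, l) \<in> short_arcs n" "(s', l') \<in> short_arcs n" "colour n s l = colour n s' l'"
    "i < l" "i' < l'" "(s + i) mod (2 * n) = (s' + i') mod (2 * n)"
  shows "s = s' \<and> l = l'"
proof -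
  obtain c x where c: "colour n s l = (c, x)" by fastforce
  then have c': "colour n s' l' = (c, x)" using assms by simp
  have b: "s < 2 * n" "l \<le> n" "s' < 2 * n" "l' \<le> n"
    using assms(2,3) by (auto simp: short_arcs_def)
  \<comment> \<open>Both sums are below \<open>3 * n\<close>, so they differ by 0 or by
    \<open>2 * n\<close>.\<close>
  have e: "s + i = s' + i' \<or> s + i = s' + i' + 2 * n \<or> s + i + 2 * n = s' + i'"
    using assms(5-7) b by (auto simp: add_mod_double split: if_splits)
  show ?thesis
  proof (rule ccontr)
    assume "\<not> ?thesis"
    then have ne: "s \<noteq> s' \<or> l \<noteq> l'" by blast
    note facts = ne e assms(1,5,6) b
    \<comment> \<open>Both arcs are split by \<open>colour_cases\<close>; each pair of cases falls
      to linear arithmetic or to a parity clash.\<close>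
    show False
      using assms(1) assms(2) c
    proof (cases rule: colour_cases)
      case unit_low
      show False using assms(1,3) c'
        by (cases rule: colour_cases)
          (insert facts unit_low,
            (linarith | (elim disjE conjE; ((erule notE, assumption) | linarith)))+)
    next
      case unit_high
      show False using assms(1,3) c'
        by (cases rule: colour_cases)
          (insert facts unit_high,
            (linarith | (elim disjE conjE; ((erule notE, assumption) | linarith)))+)
    next
      case long_low
      show False using assms(1,3) c'
        by (cases rule: colour_cases)
          (insert facts long_low,
            (linarith | (elim disjE conjE; ((erule notE, assumption) | linarith)))+)
    next
      case long_high
      show False using assms(1,3) c'
        by (cases rule: colour_cases)
          (insert facts long_high,
            (linarith | (elim disjE conjE; ((erule notE, assumption) | linarith)))+)
    next
      case long_zero
      show False using assms(1,3) c'
        by (cases rule: colour_cases)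
          (insert facts long_zero,
            (linarith | (elim disjE conjE; ((erule notE, assumption) | linarith)))+)
    next
      case diam
      show False using assms(1,3) c'
        by (cases rule: colour_cases)
          (insert facts diam,
            (linarith | (elim disjE conjE; ((erule notE, assumption) | linarith)))+)
    next
      case unit_diam
      show False using assms(1,3) c'
        by (cases rule: colour_cases)
          (insert facts unit_diam,
            (linarith | (elim disjE conjE; ((erule notE, assumption) | linarith)))+)
    next
      case long_diam
      show False using assms(1,3) c'
        by (cases rule: colour_cases)
          (insert facts long_diam,
            (linarith | (elim disjE conjE; ((erule notE, assumption) | linarith)))+)
    next
      case lower
      show False using assms(1,3) c'
        by (cases rule: colour_cases)
          (insert facts lower,
            (linarith | (elim disjE conjE; ((erule notE, assumption) | linarith)))+)
    next
      case upper
      show False using assms(1,3) c'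
        by (cases rule: colour_cases)
          (insert facts upper,
            (linarith | (elim disjE conjE; ((erule notE, assumption) | linarith)))+)
    next
      case middle
      show False using assms(1,3) c'
        by (cases rule: colour_cases)
          (insert facts middle,
            (linarith | (elim disjE conjE; ((erule notE, assumption) | linarith)))+)
    qed
  qed
qed

section \<open>Small cases and conclusion\<close>

lemma short_arcs_packing_exists:
  assumes "n \<ge> 1"
  shows "\<exists>\<omega>. global_packing ((\<lambda>(s, l). arc (2 * n) s l) ` short_arcs n)
    ((n choose 2) + n div 2 + 1) \<omega>"
proof -
  \<comment> \<open>For \<open>n = 1\<close> the cycle is a single edge, and for
    \<open>n = 2\<close> the lengths 1 and \<open>n - 1\<close> coincide; \<open>colour\<close>
    serves the rest.\<close>
  consider "n = 1" | "n = 2" | "n \<ge> 3" using assms by linarith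
  then show ?thesis
  proof cases
    case 1
    have "short_arcs 1 = {(0, 1)}" by (auto simp: short_arcs_def diam_starts_def)
    then have "global_packing ((\<lambda>(s, l). arc (2 * n) s l) ` short_arcs n) 1 (\<lambda>_. 1)"
      unfolding 1 global_packing_def by simp
    moreover have "(n choose 2) + n div 2 + 1 = 1" by (simp add: 1)
    ultimately show ?thesis by metis
  next
    case 2
    \<comment> \<open>The four single edges share a colour; the two arcs of length 2, starting at 0
      and 3, get one each.\<close>
    define c where "c s l = (if l = 1 then 0 else if s = 0 then 1 else (2::nat))" for s l :: nat
    have arcs: "s < 4 \<and> (l = 1 \<or> l = 2 \<and> (s = 0 \<or> s = 3))" if "(s, l) \<in> short_arcs 2" for s l
    proof -
      have "s = 0 \<or> s = 3" if "s \<in> diam_starts 2"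
        using that unfolding diam_starts_def mem_Collect_eq by presburger
      then show ?thesis using that by (auto simp: short_arcs_def)
    qed
    have three: "(n choose 2) + n div 2 + 1 = 3" using 2 by (simp add: choose_two)
    show ?thesis
      unfolding three
    proof (rule short_arcs_packing[where C = "{..<3}" and c = c])
      fix s l s' l' i i'
      assume "(s, l) \<in> short_arcs n" "(s', l') \<in> short_arcs n" and c: "c s l = c s' l'"
        and i: "i < l" "i' < l'" "(s + i) mod (2 * n) = (s' + i') mod (2 * n)"
      then have "s < 4 \<and> (l = 1 \<or> l = 2 \<and> (s = 0 \<or> s = 3))"
        "s' < 4 \<and> (l' = 1 \<or> l' = 2 \<and> (s' = 0 \<or> s' = 3))"
        using 2 arcs by auto
      then consider "l = 1" "l' = 1" "s < 4" "s' < 4" | "l = 2" "l' = 2" "s = s'"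
        using c by (auto simp: c_def split: if_splits)
      then show "s = s' \<and> l = l'" using i 2 by cases auto
    qed (use 2 in \<open>auto simp: c_def\<close>)
  next
    case 3
    show ?thesis
    proof (rule short_arcs_packing[where C = "colours n" and c = "colour n"])
      show "colour n s l \<in> colours n" if "(s, l) \<in> short_arcs n" for s l
        using colour_in_colours 3 that .
    qed (use 3 card_colours[OF 3] colour_disjoint[OF 3] in \<open>auto\<close>)
  qed
qed

theorem theorem1:
  fixes n :: nat
  assumes "n \<ge> 1"
  shows "Phi (cycle_graph (2 * n)) = (n choose 2) + n div 2 + 1"
proof -
  obtain \<omega> where "global_packing ((\<lambda>(s, l). arc (2 * n) s l) ` short_arcs n)
      ((n choose 2) + n div 2 + 1) \<omega>"
    using short_arcs_packing_exists[OF assms] by blast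
  then show ?thesis
    using path_system_short_arcs cycle_packing_lower_bound[OF assms]
    by (intro Phi_eqI) (auto simp: cycle_graph_def)
qed

end
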